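(* Let $S\subseteq\mathbb{N}_0^d$ be a generalized numerical semigroup with corner element $\mathbf{c}$ and positive genus. Then $S$ is an atom (of $\mathcal{F}(\mathbf{c})$) if and only if $S \in \mathcal{M}\mathcal{F}(\mathbf{c}; \mathbf{h})$ for some $\mathbf{h}\in \mathbb{N}_0^d$.
   Context: $\mathbb{N}_0$ is the set of non-negative integers and $d\ge 1$ is an integer. A generalized numerical semigroup (GNS) in $\mathbb{N}_0^d$ is a subset $S\subseteq\mathbb{N}_0^d$ closed under addition, containing $\mathbf{0}$, with finite complement $\operatorname{H}(S)=\mathbb{N}_0^d\setminus S$ (the gaps of $S$); the genus of $S$ is $|\operatorname{H}(S)|$. On $\mathbb{N}_0^d$, $\leq$ is the componentwise partial order; $\mathbf{1}=(1,\dots,1)$. Corner element: the corner element of a GNS $S$ is the unique $\mathbf{c}=(c_1,\dots,c_d)\in S$ such that (1) for all $i$ and all $x\in\mathbb{N}_0$ with $x\ge c_i$, every vector of $\mathbb{N}_0^d$ with $i$-th coordinate $x$ lies in $S$; (2) for all $i$, there are $z_j\in\mathbb{N}_0$ ($j\neq i$) such that $(z_1,\dots,z_{i-1},c_i-1,z_{i+1},\dots,z_d)\notin S$. (If $\operatorname{H}(S)\ne\emptyset$, then $c_i=1+\max\{h_i:\mathbf{h}\in \operatorname{H}(S)\}$ for each $i$.) $\mathcal{F}(\mathbf{c})$ is the set of all GNSs in $\mathbb{N}_0^d$ with corner element $\mathbf{c}$. An element $S\in\mathcal{F}(\mathbf{c})$ is an atom if it cannot be written as an intersection of two GNSs in $\mathcal{F}(\mathbf{c})$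 both properly containing $S$. For $\mathbf{h}\le\mathbf{c}-\mathbf{1}$, $\mathcal{F}(\mathbf{c};\mathbf{h})=\{S\in\mathcal{F}(\mathbf{c}) : \mathbf{h}\in\operatorname{H}(S)\}$, and $\mathcal{M}\mathcal{F}(\mathbf{c};\mathbf{h})$ is the set of elements of $\mathcal{F}(\mathbf{c};\mathbf{h})$ maximal with respect to inclusion. *)

theory Defs
  imports "HOL-Analysis.Finite_Cartesian_Product"
begin

text \<open>
  The monoid of \<open>d\<close>-tuples of non-negative integers is the type \<open>nat ^ 'd\<close>, with \<open>d = CARD('d) \<ge> 1\<close>;
  the library order on this type is the componentwise one.
\<close>

definition gaps :: "(nat ^ 'd) set \<Rightarrow> (nat ^ 'd) set" where
  "gaps S = - S"

definition genus :: "(nat ^ 'd) set \<Rightarrow> nat" where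
  "genus S = card (gaps S)"

definition gns :: "(nat ^ 'd) set \<Rightarrow> bool" where
  "gns S \<longleftrightarrow> 0 \<in> S \<and> (\<forall>x\<in>S. \<forall>y\<in>S. x + y \<in> S) \<and> finite (gaps S)"

text \<open>
  If \<open>c $ i = 0\<close>, a tuple with \<open>i\<close>-th entry \<open>c $ i - 1 = -1\<close> lies outside the monoid, hence outside
  \<open>S\<close>, so the second condition holds at \<open>i\<close>. This case is split off because subtraction on \<open>nat\<close>
  truncates. It occurs only for \<open>S = UNIV\<close>, whose corner element is thus \<open>0\<close>.
\<close>

definition is_corner :: "(nat ^ 'd) set \<Rightarrow> nat ^ 'd \<Rightarrow> bool" where
  "is_corner S c \<longleftrightarrow>
     c \<in> S \<and>
     (\<forall>i. \<forall>x \<ge> c $ i. \<forall>v. v $ i = x \<longrightarrow> v \<in> S) \<and>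
     (\<forall>i. c $ i = 0 \<or> (\<exists>z. z $ i = c $ i - 1 \<and> z \<notin> S))"

definition GNS_corner :: "nat ^ 'd \<Rightarrow> (nat ^ 'd) set set" where
  "GNS_corner c = {S. gns S \<and> is_corner S c}"

definition atom :: "nat ^ 'd \<Rightarrow> (nat ^ 'd) set \<Rightarrow> bool" where
  "atom c S \<longleftrightarrow>
     S \<in> GNS_corner c \<and>
     \<not> (\<exists>T\<in>GNS_corner c. \<exists>U\<in>GNS_corner c. S \<subset> T \<and> S \<subset> U \<and> S = T \<inter> U)"

text \<open>
  The restriction \<open>h \<le> c - 1\<close> on the parameter \<open>h\<close> need not be imposed: it holds for every gap, see
  \<open>gap_le_corner\<close> below, so the following family is empty for all other \<open>h\<close>.
\<close>

definition GNS_corner_gap :: "nat ^ 'd \<Rightarrow> nat ^ 'd \<Rightarrow> (nat ^ 'd) set set" where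
  "GNS_corner_gap c h = {S \<in> GNS_corner c. h \<in> gaps S}"

definition max_GNS_corner_gap :: "nat ^ 'd \<Rightarrow> nat ^ 'd \<Rightarrow> (nat ^ 'd) set set" where
  "max_GNS_corner_gap c h =
     {S \<in> GNS_corner_gap c h. \<not> (\<exists>T\<in>GNS_corner_gap c h. S \<subset> T)}"

lemma gap_less_corner:
  assumes "is_corner S c" "h \<in> gaps S"
  shows "h $ i < c $ i"
proof (rule ccontr)
  assume "\<not> h $ i < c $ i"
  then have "c $ i \<le> h $ i" by simp
  then have "h \<in> S"
    using assms(1) unfolding is_corner_def by blast
  with assms(2) show False by (simp add: gaps_def)
qed

lemma gap_le_corner:
  assumes "is_corner S c" "h \<in> gaps S"
  shows "h \<le> c - 1"
  unfolding less_eq_vec_def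
proof
  fix i
  show "h $ i \<le> (c - 1) $ i"
    using gap_less_corner[OF assms, of i] by simp
qed

lemma is_corner_unique:
  assumes "is_corner S c" "is_corner S c'"
  shows "c = c'"
proof -
  have le: "b $ i \<le> a $ i" if a: "is_corner S a" and b: "is_corner S b" for a b i
  proof (rule ccontr)
    assume less: "\<not> b $ i \<le> a $ i"
    then obtain z where z: "z $ i = b $ i - 1" "z \<notin> S"
      using b unfolding is_corner_def by (metis le0)
    then have "z $ i < a $ i"
      using gap_less_corner[OF a, of z i] by (simp add: gaps_def)
    with z less show False by simp
  qed
  show ?thesis
    using le[OF assms] le[OF assms(2,1)] by (simp add: vec_eq_iff order_antisym)
qed

lemma is_corner_Max:
  assumes "gns S" "gaps S \<noteq> {}"
  shows "is_corner S (\<chi> i. 1 + Max ((\<lambda>h. h $ i) ` gaps S))"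
proof -
  let ?c = "\<chi> i. 1 + Max ((\<lambda>h. h $ i) ` gaps S)"
  have fin: "finite (gaps S)"
    using assms(1) by (simp add: gns_def)
  have in_S: "v \<in> S" if v: "?c $ i \<le> v $ i" for v i
  proof (rule ccontr)
    assume "v \<notin> S"
    then have "v $ i \<le> Max ((\<lambda>h. h $ i) ` gaps S)"
      using fin by (intro Max_ge) (auto simp: gaps_def)
    with v show False by simp
  qed
  have attained: "\<exists>z. z $ i = ?c $ i - 1 \<and> z \<notin> S" for i
  proof -
    have "Max ((\<lambda>h. h $ i) ` gaps S) \<in> (\<lambda>h. h $ i) ` gaps S"
      using fin assms(2) by (intro Max_in) auto
    then show ?thesis by (auto simp: gaps_def)
  qed
  show ?thesis
    unfolding is_corner_def using in_S attained by blast
qed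

lemma is_corner_UNIV: "is_corner UNIV 0"
  by (simp add: is_corner_def)

end

theory Submission
  imports Defs
begin

text \<open>
  If every gap \<open>h\<close> of an atom \<open>S\<close> were missed by some proper overset \<open>T\<^sub>h\<close> in the family, then \<open>S\<close> would
  be the intersection of the finitely many \<open>T\<^sub>h\<close>. But the family is closed under intersection, so the
  proper oversets of an atom are too, and no such finite intersection can shrink to \<open>S\<close>.
\<close>

lemma gns_Int:
  assumes "gns T" "gns U"
  shows "gns (T \<inter> U)"
  using assms by (auto simp: gns_def gaps_def Compl_Int)

text \<open>A gap of \<open>T\<close> is also a gap of \<open>T \<inter> U\<close>, so the witnesses
  that \<open>c\<close> cannot be lowered for \<open>T\<close> serve again.\<close>

lemma is_corner_Int:
  assumes "is_corner T c" "is_corner U c"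
  shows "is_corner (T \<inter> U) c"
  unfolding is_corner_def
proof (intro conjI allI impI)
  fix i
  show "c $ i = 0 \<or> (\<exists>z. z $ i = c $ i - 1 \<and> z \<notin> T \<inter> U)"
    using assms(1) unfolding is_corner_def by (metis IntD1)
qed (use assms in \<open>simp_all add: is_corner_def\<close>)

lemma GNS_corner_Int:
  assumes "T \<in> GNS_corner c" "U \<in> GNS_corner c"
  shows "T \<inter> U \<in> GNS_corner c"
  using assms by (simp add: GNS_corner_def gns_Int is_corner_Int)

lemma atom_proper_overset_Int:
  assumes "atom c S" "T \<in> GNS_corner c" "U \<in> GNS_corner c" "S \<subset> T" "S \<subset> U"
  shows "S \<subset> T \<inter> U"
  using assms unfolding atom_def by blast

text \<open>Induction on \<open>A\<close>: intersect an overset avoiding \<open>A\<close> with one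
  avoiding the new \<open>h\<close>. The start is a singleton, since for empty \<open>A\<close> the
  family need not contain a proper overset of \<open>S\<close>.\<close>

lemma atom_proper_overset_avoiding:
  assumes "atom c S" "finite A" "A \<noteq> {}"
    and "\<And>h. h \<in> A \<Longrightarrow> \<exists>T\<in>GNS_corner c. S \<subset> T \<and> h \<notin> T"
  shows "\<exists>T\<in>GNS_corner c. S \<subset> T \<and> A \<inter> T = {}"
  using assms(2-4)
proof (induction rule: finite_ne_induct)
  case (singleton h)
  then show ?case by blast
next
  case (insert h A)
  then obtain T where T: "T \<in> GNS_corner c" "S \<subset> T" "A \<inter> T = {}"
    by blast
  obtain U where U: "U \<in> GNS_corner c" "S \<subset> U" "h \<notin> U"
    using insert.prems by blast
  have "S \<subset> T \<inter> U"
    using atom_proper_overset_Int[OF assms(1)] T U by blast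
  moreover have "insert h A \<inter> (T \<inter> U) = {}"
    using T(3) U(3) by blast
  ultimately show ?case
    using GNS_corner_Int[OF T(1) U(1)] by blast
qed

lemma atom_imp_max_GNS_corner_gap:
  assumes "atom c S" "gaps S \<noteq> {}"
  shows "\<exists>h. S \<in> max_GNS_corner_gap c h"
proof (rule ccontr)
  assume not_max: "\<not> (\<exists>h. S \<in> max_GNS_corner_gap c h)"
  have S: "S \<in> GNS_corner c"
    using assms(1) by (simp add: atom_def)
  then have "finite (gaps S)"
    by (simp add: GNS_corner_def gns_def)
  \<comment> \<open>\<open>S\<close> is not maximal among the members with gap \<open>h\<close>, so
    some larger member still omits \<open>h\<close>.\<close>
  moreover have "\<exists>T\<in>GNS_corner c. S \<subset> T \<and> h \<notin> T" if "h \<in> gaps S" for h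
    using not_max S that by (auto simp: max_GNS_corner_gap_def GNS_corner_gap_def gaps_def)
  ultimately obtain T where "S \<subset> T" "gaps S \<inter> T = {}"
    using atom_proper_overset_avoiding[OF assms(1) _ assms(2)] by blast
  \<comment> \<open>A proper overset of \<open>S\<close> contains some gap of
    \<open>S\<close>.\<close>
  then show False
    by (auto simp: gaps_def)
qed

text \<open>By maximality all proper oversets of \<open>S\<close> in the family contain
  \<open>h\<close>, hence so does the intersection of any two, while \<open>S\<close> omits
  \<open>h\<close>.\<close>

lemma max_GNS_corner_gap_imp_atom:
  assumes "S \<in> max_GNS_corner_gap c h"
  shows "atom c S"
proof -
  have S: "S \<in> GNS_corner c" "h \<notin> S"
    using assms by (auto simp: max_GNS_corner_gap_def GNS_corner_gap_def gaps_def)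
  have "h \<in> T" if "T \<in> GNS_corner c" "S \<subset> T" for T
    using assms that by (auto simp: max_GNS_corner_gap_def GNS_corner_gap_def gaps_def)
  then show ?thesis
    using S unfolding atom_def by blast
qed

theorem theorem4p9:
  fixes S :: "(nat ^ 'd) set" and c :: "nat ^ 'd"
  assumes "gns S"
    and "is_corner S c"
    and "genus S > 0"
  shows "atom c S \<longleftrightarrow> (\<exists>h :: nat ^ 'd. S \<in> max_GNS_corner_gap c h)"
proof -
  have "gaps S \<noteq> {}"
    using assms(3) by (auto simp: genus_def)
  then show ?thesis
    using atom_imp_max_GNS_corner_gap max_GNS_corner_gap_imp_atom by blast
qed

end
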